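(* Let $U=\mathbb{R}\times\,]-1,1[\,\subset\mathbb{R}^2$ with coordinates $(x,y)$, endowed with the constant cone field $\mathcal{C}(x,y)=\{(v_x,v_y)\neq(0,0): v_y\geq|v_x|\}$. Let $\varphi:]-1,1[\to\mathbb{R}$ be a smooth increasing function onto $\mathbb{R}$, and let $h:U\to\mathbb{R}$ be the function $$h(x,y)=\frac{y}{1+x^2}+\varphi(y).$$ If $\varphi'(0)=0$, then $h$ is not completely uniform for $\mathcal{C}$.
   Context: Given a Riemannian metric $g$ on $U$, a smooth function $\tau:U\to\mathbb{R}$ is a $g$-uniform temporal function for $\mathcal{C}$ if $d\tau_p\cdot v\geq\sqrt{g_p(v,v)}$ for each $p\in U$ and each $v\in\mathcal{C}(p)$ (and $d\tau_p\cdot v>0$). A temporal function is completely uniform if it is $g$-uniform for some complete Riemannian metric $g$ on $U$. *)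

theory Defs
  imports "HOL-Analysis.Analysis"
begin

text \<open>
  C^k regularity on an open subset of a finite-dimensional space: f is differentiable at every
  point and each directional derivative is of class C^(k-1).
\<close>

primrec Ck_on :: "nat \<Rightarrow> 'a::euclidean_space set \<Rightarrow> ('a \<Rightarrow> real) \<Rightarrow> bool" where
  "Ck_on 0 U f \<longleftrightarrow> continuous_on U f"
| "Ck_on (Suc k) U f \<longleftrightarrow>
     (\<forall>p\<in>U. f differentiable (at p)) \<and>
     (\<forall>v. Ck_on k U (\<lambda>p. frechet_derivative f (at p) v))"

definition smooth_on :: "'a::euclidean_space set \<Rightarrow> ('a \<Rightarrow> real) \<Rightarrow> bool" where
  "smooth_on U f \<longleftrightarrow> (\<forall>k. Ck_on k U f)"

definition riemannian_metric_on ::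
    "'a::euclidean_space set \<Rightarrow> ('a \<Rightarrow> 'a \<Rightarrow> 'a \<Rightarrow> real) \<Rightarrow> bool" where
  "riemannian_metric_on U g \<longleftrightarrow>
     (\<forall>p\<in>U. bilinear (g p) \<and> (\<forall>u v. g p u v = g p v u) \<and> (\<forall>v. v \<noteq> 0 \<longrightarrow> g p v v > 0)) \<and>
     (\<forall>u v. smooth_on U (\<lambda>p. g p u v))"

text \<open>
  The length is taken as a relation, not as a value of the integral operator: a
  \<open>valid_path\<close> may have unbounded speed near its break points, and the integral operator
  returns 0 on a speed that is not integrable, so that curves of infinite length
  would otherwise count as having length 0.
\<close>

definition has_riemannian_length ::
    "('a::euclidean_space \<Rightarrow> 'a \<Rightarrow> 'a \<Rightarrow> real) \<Rightarrow> (real \<Rightarrow> 'a) \<Rightarrow> real \<Rightarrow> bool" where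
  "has_riemannian_length g \<gamma> L \<longleftrightarrow>
     ((\<lambda>t. sqrt (g (\<gamma> t) (vector_derivative \<gamma> (at t)) (vector_derivative \<gamma> (at t))))
        has_integral L) {0..1}"

text \<open>
  Infimum of lengths of piecewise C^1 curves in U. The set is nonempty for p, q in a connected open
  set U, the only intended use. The extension by 0 outside U is there because \<open>Metric_space\<close>
  asks for nonnegativity and symmetry on the whole type.
\<close>

definition riemannian_dist ::
    "'a::euclidean_space set \<Rightarrow> ('a \<Rightarrow> 'a \<Rightarrow> 'a \<Rightarrow> real) \<Rightarrow> 'a \<Rightarrow> 'a \<Rightarrow> real" where
  "riemannian_dist U g p q =
     (if p \<in> U \<and> q \<in> U
      then Inf {L. \<exists>\<gamma>. valid_path \<gamma> \<and> path_image \<gamma> \<subseteq> U \<and> pathstart \<gamma> = p \<and>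
                      pathfinish \<gamma> = q \<and> has_riemannian_length g \<gamma> L}
      else 0)"

text \<open>
  For connected open U the Riemannian distance is always a metric; the locale predicate is stated
  because the facts about \<open>Metric_space.mcomplete\<close> are available only under it.
\<close>

definition complete_riemannian_metric_on ::
    "'a::euclidean_space set \<Rightarrow> ('a \<Rightarrow> 'a \<Rightarrow> 'a \<Rightarrow> real) \<Rightarrow> bool" where
  "complete_riemannian_metric_on U g \<longleftrightarrow>
     riemannian_metric_on U g \<and>
     Metric_space U (riemannian_dist U g) \<and> Metric_space.mcomplete U (riemannian_dist U g)"

definition uniform_temporal_function ::
    "'a::euclidean_space set \<Rightarrow> ('a \<Rightarrow> 'a \<Rightarrow> 'a \<Rightarrow> real) \<Rightarrow> ('a \<Rightarrow> 'a set) \<Rightarrow> ('a \<Rightarrow> real) \<Rightarrow> bool" where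
  "uniform_temporal_function U g C \<tau> \<longleftrightarrow>
     smooth_on U \<tau> \<and>
     (\<forall>p\<in>U. \<forall>v\<in>C p. frechet_derivative \<tau> (at p) v \<ge> sqrt (g p v v) \<and>
                      frechet_derivative \<tau> (at p) v > 0)"

definition completely_uniform ::
    "'a::euclidean_space set \<Rightarrow> ('a \<Rightarrow> 'a set) \<Rightarrow> ('a \<Rightarrow> real) \<Rightarrow> bool" where
  "completely_uniform U C \<tau> \<longleftrightarrow>
     (\<exists>g. complete_riemannian_metric_on U g \<and> uniform_temporal_function U g C \<tau>)"

end

theory Submission
  imports Defs
begin

text \<open>
  On the axis \<open>y = 0\<close> the differential of \<open>h\<close> at \<open>(x, 0)\<close> is \<open>dy / (1 + x\<^sup>2)\<close>, because \<open>\<phi>'\<close>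
  vanishes at 0 and the \<open>dx\<close>-component of the first summand carries a factor \<open>y\<close>. Suppose that
  \<open>h\<close> is \<open>g\<close>-uniform. The null vectors \<open>(1, 1)\<close> and \<open>(-1, 1)\<close> then have \<open>g\<close>-length at most
  \<open>1 / (1 + x\<^sup>2)\<close> there, and half their difference is \<open>(1, 0)\<close>, so the same bound holds for
  \<open>(1, 0)\<close>. The whole axis therefore has \<open>g\<close>-length at most the integral of \<open>1 / (1 + x\<^sup>2)\<close>,
  which is \<open>\<pi>\<close>, and the points \<open>(n, 0)\<close> form a Cauchy sequence that leaves every compact set.

  This is impossible when \<open>g\<close> is complete
  (\<open>complete_riemannian_MCauchy_convergent\<close>): a limit for the
  Riemannian distance is also a Euclidean limit. The reason is local. Near a point of \<open>U\<close> the
  metric dominates a multiple \<open>c\<close> of the Euclidean one (\<open>riemannian_norm_bounded_below\<close>), and a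
  path that starts at the point and ends at Euclidean distance at least \<open>r\<close> has to cross the ball
  of radius \<open>r\<close>, which costs length at least \<open>c * r\<close> (\<open>length_ge_of_leaving_ball\<close>).
\<close>

section \<open>The pointwise norm of a Riemannian metric\<close>

text \<open>
  Smoothness of a metric is a condition for each fixed pair of vectors; joint continuity
  in point and vector follows because the form is a finite combination of its coefficients in
  the standard basis.
\<close>

lemma riemannian_metric_quadratic_continuous:
  fixes U :: "'a::euclidean_space set"
  assumes g: "riemannian_metric_on U g"
  shows "continuous_on (U \<times> UNIV) (\<lambda>(p, v). g p v v)"
proof -
  have expand: "g p v v = (\<Sum>i\<in>Basis. \<Sum>j\<in>Basis. (v \<bullet> i) * (v \<bullet> j) * g p i j)" if "p \<in> U" for p v
  proof -
    have bil: "bilinear (g p)"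
      using g that by (simp add: riemannian_metric_on_def)
    have "g p v v = g p (\<Sum>i\<in>Basis. (v \<bullet> i) *\<^sub>R i) (\<Sum>j\<in>Basis. (v \<bullet> j) *\<^sub>R j)"
      by (simp add: euclidean_representation)
    also have "\<dots> = (\<Sum>(i, j)\<in>Basis \<times> Basis. g p ((v \<bullet> i) *\<^sub>R i) ((v \<bullet> j) *\<^sub>R j))"
      by (rule bilinear_sum[OF bil])
    also have "\<dots> = (\<Sum>i\<in>Basis. \<Sum>j\<in>Basis. (v \<bullet> i) * (v \<bullet> j) * g p i j)"
      by (simp add: sum.cartesian_product bilinear_lmul[OF bil] bilinear_rmul[OF bil] mult.assoc mult.left_commute)
    finally show ?thesis .
  qed
  have coeff: "continuous_on U (\<lambda>p. g p i j)" for i j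
    using g unfolding riemannian_metric_on_def smooth_on_def by (metis Ck_on.simps(1))
  have "continuous_on (U \<times> UNIV) (\<lambda>z. g (fst z) i j)" for i j
    by (rule continuous_on_compose2[OF coeff continuous_on_fst[OF continuous_on_id]]) auto
  then have "continuous_on (U \<times> UNIV)
      (\<lambda>z. \<Sum>i\<in>Basis. \<Sum>j\<in>Basis. (snd z \<bullet> i) * (snd z \<bullet> j) * g (fst z) i j)"
    by (intro continuous_intros)
  then show ?thesis
    by (rule continuous_on_eq) (auto simp: expand)
qed

lemma riemannian_metric_nonneg:
  assumes "riemannian_metric_on U g" "p \<in> U"
  shows "0 \<le> g p v v"
proof (cases "v = 0")
  case True
  then show ?thesis
    using assms by (simp add: riemannian_metric_on_def bilinear_lzero)
next
  case False
  then show ?thesis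
    using assms by (simp add: riemannian_metric_on_def less_imp_le)
qed

lemma riemannian_norm_scaleR:
  assumes "riemannian_metric_on U g" "p \<in> U"
  shows "sqrt (g p (c *\<^sub>R v) (c *\<^sub>R v)) = \<bar>c\<bar> * sqrt (g p v v)"
proof -
  have bil: "bilinear (g p)"
    using assms by (simp add: riemannian_metric_on_def)
  have "g p (c *\<^sub>R v) (c *\<^sub>R v) = c\<^sup>2 * g p v v"
    by (simp add: bilinear_lmul[OF bil] bilinear_rmul[OF bil] power2_eq_square)
  then show ?thesis
    by (simp add: real_sqrt_mult)
qed

text \<open>
  The Cauchy--Schwarz step evaluates the form at \<open>b u - a v\<close>, where \<open>a\<close> and \<open>b\<close> are the lengths
  of \<open>u\<close> and \<open>v\<close>.
\<close>

lemma riemannian_norm_triangle: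
  assumes g: "riemannian_metric_on U g" and p: "p \<in> U"
  shows "sqrt (g p (u + v) (u + v)) \<le> sqrt (g p u u) + sqrt (g p v v)"
proof -
  have bil: "bilinear (g p)" and sym: "g p v u = g p u v"
    using g p by (auto simp: riemannian_metric_on_def)
  define a b where "a = sqrt (g p u u)" and "b = sqrt (g p v v)"
  have ab: "0 \<le> a" "0 \<le> b" "g p u u = a\<^sup>2" "g p v v = b\<^sup>2"
    using riemannian_metric_nonneg[OF g p] by (auto simp: a_def b_def)
  have expand: "g p (s *\<^sub>R u + t *\<^sub>R v) (s *\<^sub>R u + t *\<^sub>R v) = s\<^sup>2 * a\<^sup>2 + 2 * s * t * g p u v + t\<^sup>2 * b\<^sup>2" for s t
    by (simp add: bilinear_ladd[OF bil] bilinear_radd[OF bil] bilinear_lmul[OF bil]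
        bilinear_rmul[OF bil] sym ab power2_eq_square algebra_simps)
  have "g p u v \<le> a * b"
  proof (cases "u = 0 \<or> v = 0")
    case True
    then show ?thesis
      using ab bil by (auto simp: bilinear_lzero bilinear_rzero)
  next
    case False
    then have "0 < a" "0 < b"
      using g p by (auto simp: a_def b_def riemannian_metric_on_def)
    have "0 \<le> b\<^sup>2 * a\<^sup>2 + 2 * b * (- a) * g p u v + (- a)\<^sup>2 * b\<^sup>2"
      using riemannian_metric_nonneg[OF g p] expand[of b "- a"] by metis
    then have "0 \<le> (2 * (a * b)) * (a * b - g p u v)"
      by (simp add: power2_eq_square algebra_simps)
    moreover have "0 < 2 * (a * b)"
      using \<open>0 < a\<close> \<open>0 < b\<close> by simp
    ultimately have "0 \<le> a * b - g p u v"
      by (simp only: zero_le_mult_iff) linarith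
    then show ?thesis
      by simp
  qed
  then have "g p (u + v) (u + v) \<le> (a + b)\<^sup>2"
    using expand[of 1 1] by (simp add: power2_eq_square algebra_simps)
  then have "sqrt (g p (u + v) (u + v)) \<le> a + b"
    using ab by (intro real_le_lsqrt) auto
  then show ?thesis
    by (simp only: a_def b_def)
qed

text \<open>
  By homogeneity it is enough to bound the form on the unit sphere; over the compact set \<open>K\<close> these
  unit vectors form a compact set, on which the positive continuous form attains its minimum.
\<close>

lemma riemannian_norm_bounded_below:
  fixes U :: "'a::euclidean_space set"
  assumes g: "riemannian_metric_on U g" and "compact K" "K \<subseteq> U"
  obtains c where "0 < c" "\<And>p v. p \<in> K \<Longrightarrow> c * norm v \<le> sqrt (g p v v)"
proof -
  let ?S = "K \<times> sphere (0::'a) 1"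
  let ?N = "\<lambda>z. sqrt (g (fst z) (snd z) (snd z))"
  have "continuous_on (U \<times> UNIV) (\<lambda>z. g (fst z) (snd z) (snd z))"
    using riemannian_metric_quadratic_continuous[OF g] by (simp add: case_prod_unfold)
  then have cont: "continuous_on ?S ?N"
    using \<open>K \<subseteq> U\<close> by (intro continuous_on_real_sqrt) (auto elim: continuous_on_subset)
  have comp: "compact ?S"
    using \<open>compact K\<close> by (intro compact_Times) auto
  have "\<exists>c>0. \<forall>z\<in>?S. c \<le> ?N z"
  proof (cases "?S = {}")
    case True
    then show ?thesis
      by (metis empty_iff zero_less_one)
  next
    case False
    obtain z where z: "z \<in> ?S" "\<forall>y\<in>?S. ?N z \<le> ?N y"
      using continuous_attains_inf[OF comp False cont] by blast
    have "fst z \<in> U" "snd z \<noteq> 0"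
      using z(1) \<open>K \<subseteq> U\<close> by auto
    then have "0 < ?N z"
      using g by (simp add: riemannian_metric_on_def)
    then show ?thesis
      using z(2) by blast
  qed
  then obtain c where c: "0 < c" "\<And>z. z \<in> ?S \<Longrightarrow> c \<le> ?N z"
    by blast
  have "c * norm v \<le> sqrt (g p v v)" if p: "p \<in> K" for p v
  proof (cases "v = 0")
    case True
    then show ?thesis
      using riemannian_metric_nonneg[OF g, of p v] p \<open>K \<subseteq> U\<close> by auto
  next
    case False
    let ?u = "inverse (norm v) *\<^sub>R v"
    have "c \<le> sqrt (g p ?u ?u)"
      using c(2)[of "(p, ?u)"] p False by simp
    then have "norm v * c \<le> norm v * sqrt (g p ?u ?u)"
      by (rule mult_left_mono) simp
    also have "\<dots> = sqrt (g p (norm v *\<^sub>R ?u) (norm v *\<^sub>R ?u))"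
      using riemannian_norm_scaleR[OF g, of p "norm v" ?u] p \<open>K \<subseteq> U\<close> by auto
    finally show ?thesis
      using False by (simp add: mult.commute)
  qed
  with c(1) that show ?thesis
    by blast
qed

section \<open>Length and Riemannian distance\<close>

lemma riemannian_length_nonneg:
  assumes g: "riemannian_metric_on U g" and "path_image \<gamma> \<subseteq> U" "has_riemannian_length g \<gamma> L"
  shows "0 \<le> L"
  using assms(3) unfolding has_riemannian_length_def
proof (rule has_integral_nonneg)
  fix t :: real
  assume "t \<in> {0..1}"
  then have "\<gamma> t \<in> U"
    using assms(2) by (auto simp: path_image_def)
  then show "0 \<le> sqrt (g (\<gamma> t) (vector_derivative \<gamma> (at t)) (vector_derivative \<gamma> (at t)))"
    using riemannian_metric_nonneg[OF g] by simp
qed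

text \<open>
  The lower bound on the metric holds on the ball only, so the estimate uses the path up to the first
  time \<open>e\<close> at which it reaches distance \<open>r\<close>. Up to then the speed dominates \<open>c\<close> times the
  Euclidean speed, whose integral is at least the displacement \<open>r\<close>; the rest of the path
  contributes a nonnegative length.
\<close>

lemma length_ge_of_leaving_ball:
  fixes \<gamma> :: "real \<Rightarrow> 'a::euclidean_space"
  assumes g: "riemannian_metric_on U g"
    and path: "valid_path \<gamma>" "path_image \<gamma> \<subseteq> U" and length: "has_riemannian_length g \<gamma> L"
    and below: "\<And>p v. p \<in> cball (pathstart \<gamma>) r \<Longrightarrow> c * norm v \<le> sqrt (g p v v)" and "0 < c"
    and exit: "r \<le> dist (pathstart \<gamma>) (pathfinish \<gamma>)"
  shows "c * r \<le> L"
proof -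
  let ?s = "\<lambda>t. sqrt (g (\<gamma> t) (vector_derivative \<gamma> (at t)) (vector_derivative \<gamma> (at t)))"
  let ?E = "{t \<in> {0..1}. r \<le> dist (\<gamma> 0) (\<gamma> t)}"
  have cont: "continuous_on {0..1} \<gamma>"
    using valid_path_imp_path[OF path(1)] by (simp add: path_def)
  have "compact ?E"
    unfolding compact_eq_bounded_closed
    using cont by (intro conjI bounded_subset[OF bounded_closed_interval[of 0 1]]
        continuous_closed_preimage_constant continuous_on_closed_Collect_le continuous_intros) auto
  moreover have "1 \<in> ?E"
    using exit by (simp add: pathstart_def pathfinish_def)
  ultimately obtain e where e: "e \<in> ?E" "\<And>t. t \<in> ?E \<Longrightarrow> e \<le> t"
    using compact_attains_inf[of ?E] by blast
  have e01: "0 \<le> e" "e \<le> 1"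
    using e(1) by auto
  obtain S where S: "finite S" "\<And>t. t \<in> {0..1} - S \<Longrightarrow> \<gamma> differentiable (at t)"
    using path(1) unfolding valid_path_def piecewise_C1_differentiable_on_def
      C1_differentiable_on_eq by blast
  have "((\<lambda>t. vector_derivative \<gamma> (at t)) has_integral (\<gamma> e - \<gamma> 0)) {0..e}"
    using S e01 cont
    by (intro fundamental_theorem_of_calculus_interior_strong[OF S(1)])
      (auto simp: vector_derivative_works[symmetric] elim: continuous_on_subset)
  then have int: "((\<lambda>t. c *\<^sub>R vector_derivative \<gamma> (at t)) has_integral c *\<^sub>R (\<gamma> e - \<gamma> 0)) {0..e}"
    by (rule has_integral_cmul)
  have speed: "?s integrable_on {0..1}" "integral {0..1} ?s = L"
    using length unfolding has_riemannian_length_def by auto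
  have speed_e: "?s integrable_on {0..e}"
    using integrable_on_subinterval[OF speed(1)] e01 by auto
  have bound: "norm (c *\<^sub>R vector_derivative \<gamma> (at t)) \<le> ?s t" if t: "t \<in> {0..<e}" for t
  proof -
    have "dist (\<gamma> 0) (\<gamma> t) < r"
      using e(2)[of t] t e01 by (cases "r \<le> dist (\<gamma> 0) (\<gamma> t)") auto
    then show ?thesis
      using below[of "\<gamma> t"] \<open>0 < c\<close> by (simp add: pathstart_def)
  qed
  have pos: "0 \<le> ?s t" if "t \<in> {0..1}" for t
  proof -
    have "\<gamma> t \<in> U"
      using path(2) that by (auto simp: path_image_def)
    then show ?thesis
      using riemannian_metric_nonneg[OF g] by simp
  qed
  have "c * r \<le> norm (c *\<^sub>R (\<gamma> e - \<gamma> 0))"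
    using e(1) \<open>0 < c\<close> by (simp add: dist_norm norm_minus_commute)
  also have "\<dots> \<le> integral {0..e} ?s"
  proof -
    \<comment> \<open>The choice of \<open>e\<close> bounds the integrand for \<open>t < e\<close>; one value does not affect the integral.\<close>
    have "norm (integral {0..e} (\<lambda>t. if t = e then 0 else c *\<^sub>R vector_derivative \<gamma> (at t)))
        \<le> integral {0..e} ?s"
    proof (rule integral_norm_bound_integral)
      show "(\<lambda>t. if t = e then 0 else c *\<^sub>R vector_derivative \<gamma> (at t)) integrable_on {0..e}"
        by (rule integrable_spike[OF has_integral_integrable[OF int], of "{e}"]) auto
      show "norm (if t = e then 0 else c *\<^sub>R vector_derivative \<gamma> (at t)) \<le> ?s t"
        if "t \<in> {0..e}" for t
        using bound[of t] pos[of t] that e01 by auto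
    qed (rule speed_e)
    moreover have "integral {0..e} (\<lambda>t. if t = e then 0 else c *\<^sub>R vector_derivative \<gamma> (at t))
        = c *\<^sub>R (\<gamma> e - \<gamma> 0)"
      by (rule integral_unique, rule has_integral_spike[OF _ _ int, of "{e}"]) auto
    ultimately show ?thesis by simp
  qed
  also have "\<dots> \<le> integral {0..1} ?s"
    using e01 pos by (intro integral_subset_le speed speed_e) auto
  finally show ?thesis
    using speed(2) by simp
qed

text \<open>
  In a convex domain the segment is a curve of finite length. This keeps the set in the definition
  of the distance nonempty, so that its infimum is a genuine one, and gives an upper bound
  for the distance.
\<close>

lemma segment_has_riemannian_length:
  fixes U :: "'a::euclidean_space set"
  assumes g: "riemannian_metric_on U g" and "convex U" "p \<in> U" "q \<in> U"
  shows "has_riemannian_length g (linepath p q)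
    (integral {0..1} (\<lambda>t. sqrt (g (linepath p q t) (q - p) (q - p))))"
proof -
  have "linepath p q t \<in> U" if "t \<in> {0..1}" for t
    using that assms closed_segment_subset linepath_in_path by blast
  then have "continuous_on {0..1} (\<lambda>t. case (linepath p q t, q - p) of (x, v) \<Rightarrow> g x v v)"
    by (intro continuous_on_compose2[OF riemannian_metric_quadratic_continuous[OF g]]
        continuous_on_Pair continuous_on_linepath continuous_on_const) auto
  then have "(\<lambda>t. sqrt (g (linepath p q t) (q - p) (q - p))) integrable_on {0..1}"
    by (intro integrable_continuous_real continuous_on_real_sqrt) simp
  then show ?thesis
    unfolding has_riemannian_length_def by (simp add: integrable_integral)
qed

lemma riemannian_dist_le_segment_length:
  fixes U :: "'a::euclidean_space set"
  assumes g: "riemannian_metric_on U g" and "convex U" "p \<in> U" "q \<in> U"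
  shows "riemannian_dist U g p q
    \<le> integral {0..1} (\<lambda>t. sqrt (g (linepath p q t) (q - p) (q - p)))"
proof -
  have "closed_segment p q \<subseteq> U"
    using assms closed_segment_subset by blast
  then show ?thesis
    using assms segment_has_riemannian_length[OF assms] riemannian_length_nonneg[OF g]
    unfolding riemannian_dist_def
    by (auto intro!: cInf_lower bdd_belowI[where m = 0] exI[of _ "linepath p q"])
qed

lemma riemannian_dist_ge_outside_ball:
  fixes U :: "'a::euclidean_space set"
  assumes g: "riemannian_metric_on U g" and "convex U" "p \<in> U" "q \<in> U"
    and below: "\<And>x v. x \<in> cball p r \<Longrightarrow> c * norm v \<le> sqrt (g x v v)" and "0 < c"
    and "r \<le> dist p q"
  shows "c * r \<le> riemannian_dist U g p q"
proof -
  let ?A = "{L. \<exists>\<gamma>. valid_path \<gamma> \<and> path_image \<gamma> \<subseteq> U \<and> pathstart \<gamma> = p \<and>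
                      pathfinish \<gamma> = q \<and> has_riemannian_length g \<gamma> L}"
  have "closed_segment p q \<subseteq> U"
    using assms closed_segment_subset by blast
  then have "integral {0..1} (\<lambda>t. sqrt (g (linepath p q t) (q - p) (q - p))) \<in> ?A"
    using segment_has_riemannian_length[OF assms(1-4)] by (auto intro!: exI[of _ "linepath p q"])
  moreover have "c * r \<le> L" if "L \<in> ?A" for L
    using that length_ge_of_leaving_ball[OF g] below \<open>0 < c\<close> \<open>r \<le> dist p q\<close> by blast
  ultimately have "c * r \<le> Inf ?A"
    by (intro cInf_greatest) auto
  then show ?thesis
    using assms by (simp add: riemannian_dist_def)
qed

text \<open>
  Completeness supplies a limit \<open>a\<close> for the Riemannian distance. If infinitely many terms stayed
  at Euclidean distance at least \<open>e\<close> from \<open>a\<close>, their Riemannian distance to \<open>a\<close> would stay at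
  least \<open>c * r\<close>, for a ball of radius \<open>r \<le> e\<close> around \<open>a\<close> inside \<open>U\<close>.
\<close>

lemma complete_riemannian_MCauchy_convergent:
  fixes U :: "'a::euclidean_space set"
  assumes complete: "complete_riemannian_metric_on U g" and "open U" "convex U"
    and cauchy: "Metric_space.MCauchy U (riemannian_dist U g) \<sigma>"
  shows "\<exists>a\<in>U. \<sigma> \<longlonglongrightarrow> a"
proof -
  have g: "riemannian_metric_on U g"
    and comp: "Metric_space.mcomplete U (riemannian_dist U g)"
    using complete by (auto simp: complete_riemannian_metric_on_def)
  interpret Metric_space U "riemannian_dist U g"
    using complete by (simp add: complete_riemannian_metric_on_def)
  obtain a where "limitin mtopology \<sigma> a sequentially"
    using comp cauchy by (auto simp: mcomplete_def)
  then have a: "a \<in> U"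
    and lim: "\<And>\<epsilon>. \<epsilon> > 0 \<Longrightarrow> \<exists>N. \<forall>n\<ge>N. \<sigma> n \<in> U \<and> riemannian_dist U g (\<sigma> n) a < \<epsilon>"
    by (auto simp: limit_metric_sequentially)
  have "\<exists>N. \<forall>n\<ge>N. dist (\<sigma> n) a < e" if "e > 0" for e
  proof -
    obtain s where s: "s > 0" "cball a s \<subseteq> U"
      using \<open>open U\<close> a open_contains_cball by blast
    define r where "r = min e s"
    have r: "r > 0" "r \<le> e" "cball a r \<subseteq> U"
      using s \<open>e > 0\<close> by (auto simp: r_def)
    obtain c where c: "0 < c" "\<And>p v. p \<in> cball a r \<Longrightarrow> c * norm v \<le> sqrt (g p v v)"
      using riemannian_norm_bounded_below[OF g compact_cball r(3)] by metis
    obtain N where N: "\<And>n. n \<ge> N \<Longrightarrow> \<sigma> n \<in> U \<and> riemannian_dist U g (\<sigma> n) a < c * r"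
      using lim[of "c * r"] c(1) r(1) by auto
    have "dist (\<sigma> n) a < e" if "n \<ge> N" for n
    proof (rule ccontr)
      assume "\<not> dist (\<sigma> n) a < e"
      then have "c * r \<le> riemannian_dist U g a (\<sigma> n)"
        using N[OF that] a r(2) c
        by (intro riemannian_dist_ge_outside_ball[OF g \<open>convex U\<close>]) (auto simp: dist_commute)
      then show False
        using N[OF that] commute[of a "\<sigma> n"] by simp
    qed
    then show ?thesis
      by blast
  qed
  then show ?thesis
    using a by (auto simp: lim_sequentially)
qed

section \<open>The axis has finite length\<close>

theorem proposition4p1:
  fixes U :: "(real \<times> real) set"
    and C :: "real \<times> real \<Rightarrow> (real \<times> real) set"
    and \<phi> :: "real \<Rightarrow> real"
    and h :: "real \<times> real \<Rightarrow> real"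
  assumes U: "U = UNIV \<times> {-1<..<1}"
    and C: "\<And>x y. C (x, y) = {(vx, vy). (vx, vy) \<noteq> (0, 0) \<and> vy \<ge> \<bar>vx\<bar>}"
    and smooth: "smooth_on {-1<..<1} \<phi>"
    and increasing: "mono_on {-1<..<1} \<phi>"
    and onto: "\<phi> ` {-1<..<1} = UNIV"
    and h: "\<And>x y. (x, y) \<in> U \<Longrightarrow> h (x, y) = y / (1 + x\<^sup>2) + \<phi> y"
    and crit: "deriv \<phi> 0 = 0"
  shows "\<not> completely_uniform U C h"
proof
  assume "completely_uniform U C h"
  then obtain g where complete: "complete_riemannian_metric_on U g"
    and uniform: "uniform_temporal_function U g C h"
    by (auto simp: completely_uniform_def)
  have g: "riemannian_metric_on U g"
    using complete by (simp add: complete_riemannian_metric_on_def)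
  interpret Metric_space U "riemannian_dist U g"
    using complete by (simp add: complete_riemannian_metric_on_def)
  have "open U" "convex U"
    unfolding U by (auto intro: open_Times convex_Times)
  have axis: "(x, 0) \<in> U" for x
    by (simp add: U)

  have "Ck_on (Suc 0) {-1<..<1} \<phi>"
    using smooth unfolding smooth_on_def by blast
  then have "\<phi> differentiable (at 0)"
    by simp
  then have \<phi>': "(\<phi> has_derivative (\<lambda>v. 0)) (at 0)"
    using crit by (metis DERIV_deriv_iff_real_differentiable has_field_derivative_def lambda_zero)
  have dh: "frechet_derivative h (at (x, 0)) (a, b) = b / (1 + x\<^sup>2)" for x a b
  proof -
    have nz: "1 + x\<^sup>2 \<noteq> 0"
      using zero_le_power2[of x] by linarith
    have "(\<phi> has_derivative (\<lambda>v. 0)) (at (snd (x, 0::real)))"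
      using \<phi>' by simp
    then have "((\<lambda>z. \<phi> (snd z)) has_derivative (\<lambda>v. 0)) (at (x, 0::real))"
      by (rule has_derivative_compose[OF has_derivative_snd[OF has_derivative_ident]])
    moreover have "((\<lambda>z. snd z / (1 + (fst z)\<^sup>2)) has_derivative (\<lambda>v. snd v / (1 + x\<^sup>2)))
        (at (x, 0::real))"
      using nz by (auto intro!: derivative_eq_intros simp: fun_eq_iff)
    ultimately have "((\<lambda>z. snd z / (1 + (fst z)\<^sup>2) + \<phi> (snd z)) has_derivative
        (\<lambda>v. snd v / (1 + x\<^sup>2) + 0)) (at (x, 0::real))"
      by (rule has_derivative_add[rotated])
    then have "(h has_derivative (\<lambda>v. snd v / (1 + x\<^sup>2) + 0)) (at (x, 0))"
      by (rule has_derivative_transform_within_open[OF _ \<open>open U\<close> axis]) (auto simp: h)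
    then show ?thesis
      by (simp add: frechet_derivative_at[symmetric])
  qed
  have null: "sqrt (g (x, 0) (a, 1) (a, 1)) \<le> 1 / (1 + x\<^sup>2)" if "\<bar>a\<bar> = 1" for x a
  proof -
    have "(a, 1) \<in> C (x, 0)"
      using that by (simp add: C)
    then have "sqrt (g (x, 0) (a, 1) (a, 1)) \<le> frechet_derivative h (at (x, 0)) (a, 1)"
      using uniform axis unfolding uniform_temporal_function_def by blast
    then show ?thesis
      by (simp only: dh)
  qed
  \<comment> \<open>\<open>(2, 0) = (1, 1) + (1, -1)\<close>, and \<open>(1, -1)\<close> is the opposite of a vector of the cone.\<close>
  have horizontal: "sqrt (g (x, 0) (l, 0) (l, 0)) \<le> \<bar>l\<bar> / (1 + x\<^sup>2)" for x l
  proof -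
    have neg: "sqrt (g (x, 0) (1, -1) (1, -1)) = sqrt (g (x, 0) (-1, 1) (-1, 1))"
      using riemannian_norm_scaleR[OF g axis, of x "-1" "(-1, 1)"] by simp
    have "sqrt (g (x, 0) (2, 0) (2, 0)) \<le> 2 / (1 + x\<^sup>2)"
      using riemannian_norm_triangle[OF g axis, of x "(1, 1)" "(1, -1)"] neg
        null[of 1 x] null[of "-1" x] by simp
    then have "(\<bar>l\<bar> / 2) * sqrt (g (x, 0) (2, 0) (2, 0)) \<le> (\<bar>l\<bar> / 2) * (2 / (1 + x\<^sup>2))"
      by (intro mult_left_mono) auto
    moreover have "sqrt (g (x, 0) (l, 0) (l, 0)) = (\<bar>l\<bar> / 2) * sqrt (g (x, 0) (2, 0) (2, 0))"
      using riemannian_norm_scaleR[OF g axis, of x "l / 2" "(2, 0)"] by simp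
    moreover have "(\<bar>l\<bar> / 2) * (2 / (1 + x\<^sup>2)) = \<bar>l\<bar> / (1 + x\<^sup>2)"
      by simp
    ultimately show ?thesis
      by (simp only:)
  qed
  have dist_axis: "riemannian_dist U g (a, 0) (b, 0) \<le> arctan b - arctan a" if "a \<le> b" for a b
  proof -
    let ?p = "linepath (a, 0) (b, 0::real)"
    have p: "?p t = (a + t * (b - a), 0)" for t
      by (simp add: linepath_def algebra_simps)
    have "((\<lambda>t. (b - a) / (1 + (a + t * (b - a))\<^sup>2)) has_integral
        arctan (a + 1 * (b - a)) - arctan (a + 0 * (b - a))) {0..1}"
    proof (rule fundamental_theorem_of_calculus)
      fix t :: real
      have "((\<lambda>t. arctan (a + t * (b - a))) has_real_derivative
          (b - a) / (1 + (a + t * (b - a))\<^sup>2)) (at t within {0..1})"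
        by (auto intro!: derivative_eq_intros simp: field_simps)
      then show "((\<lambda>t. arctan (a + t * (b - a))) has_vector_derivative
          (b - a) / (1 + (a + t * (b - a))\<^sup>2)) (at t within {0..1})"
        by (simp add: has_real_derivative_iff_has_vector_derivative)
    qed simp
    then have arctan: "((\<lambda>t. (b - a) / (1 + (a + t * (b - a))\<^sup>2)) has_integral
        arctan b - arctan a) {0..1}"
      by simp
    have "has_riemannian_length g ?p
        (integral {0..1} (\<lambda>t. sqrt (g (?p t) ((b, 0) - (a, 0)) ((b, 0) - (a, 0)))))"
      by (rule segment_has_riemannian_length[OF g \<open>convex U\<close> axis axis])
    then have length: "((\<lambda>t. sqrt (g (?p t) ((b, 0) - (a, 0)) ((b, 0) - (a, 0)))) has_integral
        integral {0..1} (\<lambda>t. sqrt (g (?p t) ((b, 0) - (a, 0)) ((b, 0) - (a, 0))))) {0..1}"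
      unfolding has_riemannian_length_def vector_derivative_linepath_at .
    have speed: "sqrt (g (?p t) ((b, 0) - (a, 0)) ((b, 0) - (a, 0)))
        \<le> (b - a) / (1 + (a + t * (b - a))\<^sup>2)" for t
    proof -
      have "(b, 0) - (a, 0) = (b - a, 0::real)" "\<bar>b - a\<bar> = b - a"
        using that by auto
      then show ?thesis
        using horizontal[of "a + t * (b - a)" "b - a"] by (simp only: p)
    qed
    have "integral {0..1} (\<lambda>t. sqrt (g (?p t) ((b, 0) - (a, 0)) ((b, 0) - (a, 0))))
        \<le> arctan b - arctan a"
      by (rule has_integral_le[OF length arctan speed])
    then show ?thesis
      using riemannian_dist_le_segment_length[OF g \<open>convex U\<close> axis axis, of a b]
      by (rule order_trans[rotated])
  qed

  have "MCauchy (\<lambda>n. (real n, 0))"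
    unfolding MCauchy_def
  proof (intro conjI allI impI)
    show "range (\<lambda>n. (real n, 0)) \<subseteq> U"
      using axis by auto
    fix \<epsilon> :: real
    assume "\<epsilon> > 0"
    have "(\<lambda>n. arctan (real n)) \<longlonglongrightarrow> pi / 2"
      by (rule filterlim_compose[OF tendsto_arctan_at_top filterlim_real_sequentially])
    then have "Cauchy (\<lambda>n. arctan (real n))"
      by (rule LIMSEQ_imp_Cauchy)
    then obtain N where N: "\<And>m n. m \<ge> N \<Longrightarrow> n \<ge> N \<Longrightarrow>
        \<bar>arctan (real m) - arctan (real n)\<bar> < \<epsilon>"
      using \<open>\<epsilon> > 0\<close> unfolding Cauchy_def dist_real_def by meson
    have "riemannian_dist U g (real m, 0) (real n, 0) < \<epsilon>" if "m \<ge> N" "n \<ge> N" for m n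
      using dist_axis[of "real m" "real n"] dist_axis[of "real n" "real m"] N[OF that]
        commute[of "(real m, 0)" "(real n, 0)"]
      by (cases "m \<le> n") auto
    then show "\<exists>N. \<forall>n n'. N \<le> n \<longrightarrow> N \<le> n' \<longrightarrow>
        riemannian_dist U g (real n, 0) (real n', 0) < \<epsilon>"
      by blast
  qed
  then obtain a where "(\<lambda>n. (real n, 0::real)) \<longlonglongrightarrow> a"
    using complete_riemannian_MCauchy_convergent[OF complete \<open>open U\<close> \<open>convex U\<close>] by blast
  then have "(\<lambda>n. fst (real n, 0::real)) \<longlonglongrightarrow> fst a"
    by (rule tendsto_fst)
  then have "real \<longlonglongrightarrow> fst a"
    by simp
  then show False
    using not_tendsto_and_filterlim_at_infinity[OF trivial_limit_sequentially _
        filterlim_at_top_imp_at_infinity[OF filterlim_real_sequentially]]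
    by blast
qed

end
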